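(* Let $\phi(x)=a_0x^3+a_1x^2+a_2x+a_3$ with $a_i\in\mathbb{R}$, $a_0>0$, let $\gamma=\{(x,y)\in\mathbb{R}^2:y^2=\phi(x)\}$ be the corresponding cubic curve, and let $w(x)$ be a weight function on $\Omega_\gamma=\{x\in\mathbb{R}:\phi(x)>0\}$. Let $n\ge 1$. For $n=2m$, let $N=N_n=3m$, and for $n=2m+1$, let $N=N_n=3m+1$. Let $$I_n(f):=\sum_{k=1}^{N}\lambda_{k,N}\big[f(x_{k,N},y_{k,N})+f(x_{k,N},-y_{k,N})\big],\qquad y_{k,N}=\sqrt{\phi(x_{k,N})},$$ where $x_{k,N}$, $1\le k\le N$, are the zeros of $p_N(w)$ and $\lambda_{k,N}$ are the corresponding weights of the $N$-point Gauss quadrature rule. Then $$\int_\gamma f(x,y)\,w(x)\,\mathrm{d}\sigma(x,y)=I_n(f),\qquad\forall f\in\Pi_{2n-1}(\gamma).$$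
   Context: A weight function $w$ on $\Omega_\gamma$ is a nonnegative function, not almost everywhere zero, with all moments $\int_{\Omega_\gamma}|x|^kw(x)\,\mathrm{d}x$ finite. The integral over the curve is parametrized as $$\int_\gamma f(x,y)w(x)\,\mathrm{d}\sigma(x,y)=\int_{\Omega_\gamma}\Big[f\big(x,\sqrt{\phi(x)}\big)+f\big(x,-\sqrt{\phi(x)}\big)\Big]w(x)\,\mathrm{d}x.$$ $\Pi_n(\gamma)$ is the space of polynomials in $x,y$ of total degree at most $n$ restricted to $\gamma$. $\{p_k(w)\}_{k\ge0}$, $\deg p_k(w)=k$, are the univariate orthogonal polynomials with respect to $\langle f,g\rangle_w=\int_{\Omega_\gamma}f(x)g(x)w(x)\,\mathrm{d}x$. The $N$-point Gauss quadrature rule for $w$ has nodes $x_{k,N}$ and weights $\lambda_{k,N}$ and satisfies $\int_{\Omega_\gamma}q(x)w(x)\,\mathrm{d}x=\sum_{k=1}^N\lambda_{k,N}q(x_{k,N})$ for every univariate polynomial $q$ of degree at most $2N-1$.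
   Formalization: A node may satisfy φ(x_k)<0, so y_k is not real and f(x_k,±y_k) is undefined on γ; the identity is proved as stated when all φ(x_k)≥0, and in general with y_k the principal complex square root and f evaluated through any polynomial of degree ≤2n-1 representing it. *)

theory Defs
  imports "HOL-Analysis.Analysis" "HOL-Computational_Algebra.Polynomial"
begin

definition cubic_curve :: "(real \<Rightarrow> real) \<Rightarrow> (real \<times> real) set" where
  "cubic_curve \<phi> = {(x, y). y ^ 2 = \<phi> x}"

definition Omega_curve :: "(real \<Rightarrow> real) \<Rightarrow> real set" where
  "Omega_curve \<phi> = {x. \<phi> x > 0}"

text \<open>Measurability of \<open>w\<close> on \<open>\<Omega>\<close> is part of the moment condition (case \<open>k = 0\<close>).\<close>

definition weight_function :: "real set \<Rightarrow> (real \<Rightarrow> real) \<Rightarrow> bool" where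
  "weight_function \<Omega> w \<longleftrightarrow>
     (\<forall>x\<in>\<Omega>. w x \<ge> 0) \<and>
     \<not> (AE x in lebesgue. x \<in> \<Omega> \<longrightarrow> w x = 0) \<and>
     (\<forall>k::nat. set_integrable lebesgue \<Omega> (\<lambda>x. \<bar>x\<bar> ^ k * w x))"

definition weighted_inner ::
  "real set \<Rightarrow> (real \<Rightarrow> real) \<Rightarrow> (real \<Rightarrow> real) \<Rightarrow> (real \<Rightarrow> real) \<Rightarrow> real" where
  "weighted_inner \<Omega> w f g = (LINT x:\<Omega>|lebesgue. f x * g x * w x)"

text \<open>The condition \<open>p k \<noteq> 0\<close> only matters for \<open>k = 0\<close>: the zero polynomial has
  degree 0 in the library.\<close>

definition orthogonal_polynomials ::
  "real set \<Rightarrow> (real \<Rightarrow> real) \<Rightarrow> (nat \<Rightarrow> real poly) \<Rightarrow> bool" where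
  "orthogonal_polynomials \<Omega> w p \<longleftrightarrow>
     (\<forall>k. p k \<noteq> 0 \<and> degree (p k) = k) \<and>
     (\<forall>j k. j \<noteq> k \<longrightarrow> weighted_inner \<Omega> w (poly (p j)) (poly (p k)) = 0)"

text \<open>For \<open>N \<ge> 1\<close>: \<open>x 1, \<dots>, x N\<close> enumerate the zeros of \<open>p N\<close> without repetition.\<close>

definition gauss_quadrature ::
  "real set \<Rightarrow> (real \<Rightarrow> real) \<Rightarrow> (nat \<Rightarrow> real poly) \<Rightarrow> nat \<Rightarrow> (nat \<Rightarrow> real) \<Rightarrow> (nat \<Rightarrow> real) \<Rightarrow> bool"
where
  "gauss_quadrature \<Omega> w p N x l \<longleftrightarrow>
     bij_betw x {1..N} {t. poly (p N) t = 0} \<and>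
     (\<forall>q :: real poly. degree q \<le> 2 * N - 1 \<longrightarrow>
        (LINT t:\<Omega>|lebesgue. poly q t * w t) = (\<Sum>k = 1..N. l k * poly q (x k)))"

text \<open>A real polynomial of total degree at most \<open>d\<close> in two variables, given by its
  coefficients \<open>c i j\<close>, evaluated at a real or at a complex point.\<close>

definition bipoly :: "nat \<Rightarrow> (nat \<Rightarrow> nat \<Rightarrow> real) \<Rightarrow> 'a \<Rightarrow> 'a \<Rightarrow> 'a::real_algebra_1" where
  "bipoly d c x y = (\<Sum>i\<le>d. \<Sum>j\<le>d - i. c i j *\<^sub>R (x ^ i * y ^ j))"

definition represents ::
  "(real \<Rightarrow> real) \<Rightarrow> nat \<Rightarrow> (nat \<Rightarrow> nat \<Rightarrow> real) \<Rightarrow> (real \<times> real \<Rightarrow> real) \<Rightarrow> bool" where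
  "represents \<phi> d c f \<longleftrightarrow> (\<forall>(x, y) \<in> cubic_curve \<phi>. f (x, y) = bipoly d c x y)"

text \<open>Elements are functions on the plane of which only the values on the curve matter.\<close>

definition Pi_curve :: "(real \<Rightarrow> real) \<Rightarrow> nat \<Rightarrow> (real \<times> real \<Rightarrow> real) set" where
  "Pi_curve \<phi> d = {f. \<exists>c. represents \<phi> d c f}"

definition curve_integral ::
  "(real \<Rightarrow> real) \<Rightarrow> (real \<Rightarrow> real) \<Rightarrow> (real \<times> real \<Rightarrow> real) \<Rightarrow> real" where
  "curve_integral \<phi> w f =
     (LINT x:Omega_curve \<phi>|lebesgue. (f (x, sqrt (\<phi> x)) + f (x, - sqrt (\<phi> x))) * w x)"

definition curve_rule ::
  "(real \<Rightarrow> real) \<Rightarrow> nat \<Rightarrow> (nat \<Rightarrow> real) \<Rightarrow> (nat \<Rightarrow> real) \<Rightarrow> (real \<times> real \<Rightarrow> real) \<Rightarrow> real" where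
  "curve_rule \<phi> N x l f =
     (\<Sum>k = 1..N. l k * (f (x k, sqrt (\<phi> (x k))) + f (x k, - sqrt (\<phi> (x k)))))"

text \<open>If \<open>\<phi>\<close> has three real zeros, a zero of \<open>p N\<close> may fall in the gap of \<open>\<Omega>\<close>, where
  \<open>\<phi> < 0\<close>. The node \<open>(x, \<plusminus> sqrt (\<phi> x))\<close> then lies on the complex curve, whereas the library's
  real \<open>sqrt\<close> would give \<open>- sqrt \<bar>\<phi> x\<bar>\<close>; hence the principal complex root here.\<close>

definition curve_rule_complex ::
  "(real \<Rightarrow> real) \<Rightarrow> nat \<Rightarrow> (nat \<Rightarrow> real) \<Rightarrow> (nat \<Rightarrow> real) \<Rightarrow> (complex \<Rightarrow> complex \<Rightarrow> complex) \<Rightarrow> complex"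
where
  "curve_rule_complex \<phi> N x l F =
     (\<Sum>k = 1..N. of_real (l k) *
        (F (of_real (x k)) (csqrt (of_real (\<phi> (x k)))) +
         F (of_real (x k)) (- csqrt (of_real (\<phi> (x k))))))"

end

theory Submission
  imports Defs
begin

text \<open>In \<open>f(x, y) + f(x, -y)\<close> the odd powers of \<open>y\<close> cancel and \<open>y\<^sup>2 = \<phi>(x)\<close> turns the rest into
  a univariate polynomial. The monomial \<open>x\<^sup>i y\<^bsup>2s\<^esup>\<close> with \<open>i + 2s \<le> 2n - 1\<close> contributes degree
  \<open>i + 3s \<le> 2n - 1 + s \<le> 3n - 2 \<le> 2N - 1\<close>, so the Gauss rule integrates it exactly.\<close>

definition fiber_sum_poly :: "real poly \<Rightarrow> nat \<Rightarrow> (nat \<Rightarrow> nat \<Rightarrow> real) \<Rightarrow> real poly" where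
  "fiber_sum_poly P d c =
     (\<Sum>i\<le>d. \<Sum>j\<le>d - i. if even j then smult (2 * c i j) (monom 1 i * P ^ (j div 2)) else 0)"

text \<open>Only \<open>y ^ 2\<close> enters, so any square root of \<open>poly P t\<close> will do.
  The type of \<open>y\<close> is left general because the identity is applied both to real roots on
  the curve and to complex roots at nodes where \<phi> may be negative.\<close>

lemma bipoly_fiber_sum:
  fixes y :: "'a::real_algebra_1"
  assumes "y ^ 2 = of_real (poly P t)"
  shows "bipoly d c (of_real t) y + bipoly d c (of_real t) (- y) =
           of_real (poly (fiber_sum_poly P d c) t)"
proof -
  have "c i j *\<^sub>R (of_real t ^ i * y ^ j) + c i j *\<^sub>R (of_real t ^ i * (- y) ^ j) =
      of_real (poly (if even j then smult (2 * c i j) (monom 1 i * P ^ (j div 2)) else 0) t)" for i j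
  proof (cases "even j")
    case True
    then obtain s where s: "j = 2 * s" by (elim evenE)
    have "y ^ j = of_real (poly P t ^ s)"
      by (simp add: s power_mult assms)
    then show ?thesis
      using s by (simp add: poly_monom scaleR_conv_of_real mult.assoc flip: mult_2)
  next
    case False
    then show ?thesis by simp
  qed
  then show ?thesis
    unfolding bipoly_def fiber_sum_poly_def by (simp add: poly_sum flip: sum.distrib)
qed

lemma degree_fiber_sum_poly:
  assumes "degree P \<le> 3" "n \<ge> 1"
  shows "degree (fiber_sum_poly P (2 * n - 1) c) \<le> 3 * n - 2"
  unfolding fiber_sum_poly_def
proof (intro degree_sum_le finite_atMost)
  fix i j assume ij: "i \<in> {..2 * n - 1}" "j \<in> {..2 * n - 1 - i}"
  show "degree (if even j then smult (2 * c i j) (monom 1 i * P ^ (j div 2)) else 0) \<le> 3 * n - 2"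
  proof (cases "even j")
    case True
    then obtain s where s: "j = 2 * s" by (elim evenE)
    have "degree (smult (2 * c i j) (monom 1 i * P ^ s)) \<le> degree (monom (1::real) i * P ^ s)"
      by (rule degree_smult_le)
    also have "\<dots> \<le> degree (monom (1::real) i) + degree (P ^ s)"
      by (rule degree_mult_le)
    also have "\<dots> \<le> i + 3 * s"
      using degree_monom_le[of "1::real" i] degree_power_le[of P s]
        mult_right_mono[OF assms(1), of s] by linarith
    \<comment> \<open>Since \<open>2 * n - 1\<close> is odd, i + 2s \<le> 2n - 1 forces s \<le> n -
      1; the bound is attained at i = 1, s = n - 1.\<close>
    also have "\<dots> \<le> 3 * n - 2"
      using ij s assms(2) by auto
    finally show ?thesis using s by simp
  qed simp
qed

text \<open>On \<Omega> the value of \<phi> is positive, so both points over t lie on the real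
  curve, where f agrees with its representing polynomial. Off \<Omega> the indicator makes both
  integrands vanish.\<close>

lemma curve_integral_eq_fiber_sum:
  assumes "represents (poly P) d c f"
  shows "curve_integral (poly P) w f =
           (LINT t:Omega_curve (poly P)|lebesgue. poly (fiber_sum_poly P d c) t * w t)"
proof -
  have "f (t, sqrt (poly P t)) + f (t, - sqrt (poly P t)) = poly (fiber_sum_poly P d c) t"
    if "t \<in> Omega_curve (poly P)" for t
    using assms that bipoly_fiber_sum[of "sqrt (poly P t)" P t d c]
    by (auto simp: represents_def cubic_curve_def Omega_curve_def)
  then show ?thesis
    unfolding curve_integral_def set_lebesgue_integral_def
    by (intro Bochner_Integration.integral_cong) (auto simp: indicator_def)
qed

theorem theorem3p1:
  fixes a0 a1 a2 a3 :: real and \<phi> w :: "real \<Rightarrow> real" and p :: "nat \<Rightarrow> real poly"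
    and n N :: nat and x l :: "nat \<Rightarrow> real"
  assumes "a0 > 0"
    and "\<phi> = (\<lambda>t. a0 * t ^ 3 + a1 * t ^ 2 + a2 * t + a3)"
    and "weight_function (Omega_curve \<phi>) w"
    and "orthogonal_polynomials (Omega_curve \<phi>) w p"
    and "n \<ge> 1"
    and "\<And>m. n = 2 * m \<Longrightarrow> N = 3 * m"
    and "\<And>m. n = 2 * m + 1 \<Longrightarrow> N = 3 * m + 1"
    and "gauss_quadrature (Omega_curve \<phi>) w p N x l"
  shows "\<forall>f \<in> Pi_curve \<phi> (2 * n - 1).
           ((\<forall>k\<in>{1..N}. \<phi> (x k) \<ge> 0) \<longrightarrow> curve_integral \<phi> w f = curve_rule \<phi> N x l f) \<and>
           (\<forall>c. represents \<phi> (2 * n - 1) c f \<longrightarrow>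
              complex_of_real (curve_integral \<phi> w f) =
                curve_rule_complex \<phi> N x l (bipoly (2 * n - 1) c))"
proof (intro ballI conjI impI allI)
  define P where "P = [:a3, a2, a1, a0:]"
  have \<phi>: "\<phi> = poly P"
    unfolding assms(2) P_def by (rule ext) (simp add: algebra_simps power2_eq_square power3_eq_cube)
  \<comment> \<open>For n = 2m this reads 6m - 2 \<le> 6m - 1; for n = 2m + 1 both sides equal 6m +
    1.\<close>
  have "3 * n - 2 \<le> 2 * N - 1"
  proof (cases "even n")
    case True
    then obtain m where "n = 2 * m" by (elim evenE)
    then show ?thesis using assms(6) by simp
  next
    case False
    then obtain m where "n = 2 * m + 1" by (elim oddE)
    then show ?thesis using assms(7) by simp
  qed
  moreover have "degree P \<le> 3"
    unfolding P_def by simp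
  ultimately have deg: "degree (fiber_sum_poly P (2 * n - 1) c) \<le> 2 * N - 1" for c
    using degree_fiber_sum_poly[OF \<open>degree P \<le> 3\<close> assms(5), of c] by linarith
  \<comment> \<open>The nodes enter only through values of a univariate polynomial, whatever the
    sign of \<phi> there, so this formula serves both claims.\<close>
  have integral: "curve_integral \<phi> w f =
      (\<Sum>k = 1..N. l k * poly (fiber_sum_poly P (2 * n - 1) c) (x k))"
    if "represents \<phi> (2 * n - 1) c f" for c f
    using curve_integral_eq_fiber_sum[of P "2 * n - 1" c f w] that assms(8) deg[of c]
    unfolding gauss_quadrature_def \<phi> by metis
  fix f assume f: "f \<in> Pi_curve \<phi> (2 * n - 1)"
  {
    assume nonneg: "\<forall>k\<in>{1..N}. \<phi> (x k) \<ge> 0"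
    obtain c where c: "represents \<phi> (2 * n - 1) c f"
      using f by (auto simp: Pi_curve_def)
    \<comment> \<open>Nonnegativity puts both points on the real curve, the only place where f is
      known to agree with c.\<close>
    have "f (x k, sqrt (\<phi> (x k))) + f (x k, - sqrt (\<phi> (x k))) =
        poly (fiber_sum_poly P (2 * n - 1) c) (x k)" if "k \<in> {1..N}" for k
      using c nonneg that bipoly_fiber_sum[of "sqrt (\<phi> (x k))" P "x k" "2 * n - 1" c]
      by (auto simp: represents_def cubic_curve_def \<phi>)
    then show "curve_integral \<phi> w f = curve_rule \<phi> N x l f"
      unfolding integral[OF c] curve_rule_def by simp
  next
    fix c assume c: "represents \<phi> (2 * n - 1) c f"
    show "complex_of_real (curve_integral \<phi> w f) =
        curve_rule_complex \<phi> N x l (bipoly (2 * n - 1) c)"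
      \<comment> \<open>\<open>csqrt\<close> squares to its argument for either sign of \<phi> at
        the node, and the polynomial c itself is evaluated instead of f, so no real point is
        required.\<close>
      using integral[OF c] unfolding curve_rule_complex_def \<phi>
      by (simp add: bipoly_fiber_sum)
  }
qed

end
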